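(* Let $A,B$ be commutative, associative $\mathbb{C}$-algebras. A linear map $f:A\to B$ is a Frobenius $n$-homomorphism if and only if for each $a\in A$ there is a polynomial $p_a(t)\in B[t]$ of degree $n$ such that $$\sum_{q=0}^{\infty}\frac{f(a^q)}{t^{q+1}}=\frac{\mathrm{d}}{\mathrm{d}t}\log p_a(t).$$
   Context: Algebras have a unit $1$, and $a^0=1$. For a linear map $f:A\to B$ and $n\ge1$, define $\Phi_n(f):A^{\otimes n}\to B$ by $\Phi_n(f)(a_1,\dots,a_n)=\sum_{\sigma\in\Sigma_n}\varepsilon_\sigma f_{\gamma_1}(a_1,\dots,a_n)\cdots f_{\gamma_r}(a_1,\dots,a_n)$, where $\Sigma_n$ is the symmetric group on $n$ letters, $\sigma=\gamma_1\cdots\gamma_r$ is the decomposition into disjoint cycles of total length $n$ (cycles of length 1 included), $\varepsilon_\sigma$ is the sign of $\sigma$, and $f_\gamma(a_1,\dots,a_n)=f(a_{i_1}a_{i_2}\cdots a_{i_m})$ for a cycle $\gamma=(i_1\dots i_m)$. A linear map $f:A\to B$ is called a Frobenius $n$-homomorphism if $f(1)=n$ and $\Phi_{n+1}(f)\equiv0$. The expression $\frac{\mathrm{d}}{\mathrm{d}t}\log p_a(t)$ is the logarithmic derivative $p_a'(t)/p_a(t)$, expanded in powers of $t^{-1}$.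
   Formalization: The polynomial p_a(t) is required to have invertible leading coefficient and B to be nonzero; otherwise the claim fails, e.g. A=C, B=C×C, f(a)=(a,2a), p_a=(t-a,(t-a)^2) has degree 2 but f(1)=(1,2)≠2. *)

theory Defs
  imports
    Complex_Main
    "HOL-Combinatorics.Permutations"
    "HOL-Combinatorics.Orbits"
    "HOL-Computational_Algebra.Formal_Laurent_Series"
begin

(* The sort asks for a commutative ring with unit that may be the zero ring;
   comm_ring_1 would impose 0 \<noteq> 1. *)

locale comm_complex_algebra = vector_space scale
  for scale :: "complex \<Rightarrow> 'a::{comm_ring, comm_monoid_mult} \<Rightarrow> 'a" +
  assumes scale_mult_left: "scale c (x * y) = scale c x * y"

(* f_\<gamma>(a_1, ..., a_n), where C is the set of letters moved round by the cycle \<gamma>;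
   the order of the factors is immaterial because the algebra is commutative. *)

definition cycle_value ::
    "('a::comm_monoid_mult \<Rightarrow> 'b) \<Rightarrow> (nat \<Rightarrow> 'a) \<Rightarrow> nat set \<Rightarrow> 'b" where
  "cycle_value f a C = f (\<Prod>i\<in>C. a i)"

(* The cycles of \<sigma>, fixed points included, are indexed by the orbits of \<sigma> on {1..n}.
   The element a_1 \<otimes> ... \<otimes> a_n is given by the values of a on {1..n}; other
   values of a are not used. *)

definition Phi ::
    "nat \<Rightarrow> ('a::comm_monoid_mult \<Rightarrow> 'b::comm_ring_1) \<Rightarrow> (nat \<Rightarrow> 'a) \<Rightarrow> 'b" where
  "Phi n f a =
     (\<Sum>\<sigma> | \<sigma> permutes {1..n}.
        of_int (sign \<sigma>) * (\<Prod>C\<in>orbit \<sigma> ` {1..n}. cycle_value f a C))"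

definition frobenius_hom ::
    "nat \<Rightarrow> ('a::comm_monoid_mult \<Rightarrow> 'b::comm_ring_1) \<Rightarrow> bool" where
  "frobenius_hom n f \<longleftrightarrow> f 1 = of_nat n \<and> (\<forall>a. Phi (n + 1) f a = 0)"

(* The library's pderiv excludes coefficient rings with zero divisors. *)

definition poly_deriv :: "'b::comm_ring_1 poly \<Rightarrow> 'b poly" where
  "poly_deriv p = (\<Sum>i\<le>degree p. monom (of_nat i * coeff p i) (i - 1))"

lemma poly_deriv_eq_pderiv: "poly_deriv p = pderiv p" for p :: "'b::idom poly"
proof (rule poly_eqI)
  fix n
  have "coeff (poly_deriv p) n =
      (\<Sum>i\<le>degree p. if i = Suc n then of_nat i * coeff p i else 0)"
    unfolding poly_deriv_def coeff_sum
    proof (rule sum.cong)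
    show "coeff (monom (of_nat i * coeff p i) (i - 1)) n =
        (if i = Suc n then of_nat i * coeff p i else 0)" for i
      by (cases i) auto
  qed simp
  also have "\<dots> = of_nat (Suc n) * coeff p (Suc n)"
    by (simp add: sum.delta' coeff_eq_0)
  finally show "coeff (poly_deriv p) n = coeff (pderiv p) n"
    by (simp add: coeff_pderiv)
qed

(* B((t^{-1})) is represented by Laurent series in X = t^{-1}, so t = fls_X_inv. *)

definition poly_at_infinity :: "'b::comm_ring_1 poly \<Rightarrow> 'b fls" where
  "poly_at_infinity p = poly (map_poly fls_const p) fls_X_inv"

lemma poly_at_infinity_nth:
  "fls_nth (poly_at_infinity p) k = (if k \<le> 0 then coeff p (nat (- k)) else 0)"
proof -
  have "poly_at_infinity p = (\<Sum>i\<le>degree p. fls_const (coeff p i) * fls_X_inv ^ i)"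
    unfolding poly_at_infinity_def
    by (simp add: poly_altdef degree_map_poly coeff_map_poly)
  then have "fls_nth (poly_at_infinity p) k =
      (\<Sum>i\<le>degree p. if i = nat (- k) \<and> k \<le> 0 then coeff p i else 0)"
    by (auto simp: fls_nth_sum intro!: sum.cong)
  then show ?thesis
    by (auto simp: sum.delta coeff_eq_0)
qed

(* p'(t) / p(t), the quotient being taken in B((t^{-1})). The expansion in powers of
   t^{-1} divides by the leading coefficient of p; when that is a unit of B, so is p(t)
   in B((t^{-1})). *)

definition log_deriv :: "'b::comm_ring_1 poly \<Rightarrow> 'b fls" where
  "log_deriv p =
     poly_at_infinity (poly_deriv p) * (THE q. poly_at_infinity p * q = 1)"

lemma log_deriv_mult:
  fixes p :: "'b::comm_ring_1 poly"
  assumes "lead_coeff p dvd 1"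
  shows "log_deriv p * poly_at_infinity p = poly_at_infinity (poly_deriv p)"
proof -
  let ?P = "poly_at_infinity p"
  obtain c where c: "lead_coeff p * c = 1"
    using assms by (metis dvdE)
  then have nz: "lead_coeff p \<noteq> 0" by auto
  have deg: "fls_subdegree ?P = - int (degree p)"
  proof (rule fls_subdegree_eqI)
    show "fls_nth ?P (- int (degree p)) \<noteq> 0"
      using nz by (simp add: poly_at_infinity_nth)
    show "fls_nth ?P k = 0" if "k < - int (degree p)" for k
      using that by (simp add: poly_at_infinity_nth coeff_eq_0)
  qed
  then have "fls_nth ?P (fls_subdegree ?P) * c = 1"
    using c by (simp add: poly_at_infinity_nth)
  then have inv: "?P * fls_right_inverse ?P c = 1"
    by (rule fls_right_inverse)
  have "(THE q. ?P * q = 1) = fls_right_inverse ?P c"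
  proof (rule the_equality)
    show "q = fls_right_inverse ?P c" if "?P * q = 1" for q
      using that inv by (metis mult.left_commute mult.right_neutral)
  qed (fact inv)
  then have "log_deriv p * ?P =
      poly_at_infinity (poly_deriv p) * (?P * fls_right_inverse ?P c)"
    by (simp add: log_deriv_def mult_ac)
  then show ?thesis
    by (simp only: inv mult_1_right)
qed

(* The sum over q of f(a^q) / t^(q+1). *)

definition power_trace_series ::
    "('a::monoid_mult \<Rightarrow> 'b::comm_ring_1) \<Rightarrow> 'a \<Rightarrow> 'b fls" where
  "power_trace_series f a = fls_X * fps_to_fls (Abs_fps (\<lambda>q. f (a ^ q)))"

end

theory Submission
  imports Defs
begin

text \<open>Splitting off one letter of the permutations gives a recursion for \<open>\<Phi>\<close> whose values
  on the diagonal are Newton's identities: \<open>\<Phi>\<^sub>m(f)(x, \<dots>, x)\<close> is \<open>(-1)^m m! d\<^sub>m\<close>, where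
  \<open>d\<^sub>0 = 1\<close> and \<open>m d\<^sub>m = - (\<Sum>j<m. f(x^(j+1)) d\<^bsub>m-1-j\<^esub>)\<close>. Multiplying \<open>\<Sum>q. f(x^q) t^(-q-1) = p'(t)/p(t)\<close>
  by \<open>p(t)\<close> and comparing coefficients shows that it amounts to \<open>f(1) = n\<close> together with this
  recursion for the coefficients of \<open>p\<close>, read from the top and divided by the leading one. Hence
  such a \<open>p\<close> exists iff \<open>f(1) = n\<close> and \<open>d\<^sub>m = 0\<close> for all \<open>m > n\<close>. The recursion for \<open>\<Phi>\<close> makes
  \<open>\<Phi>\<^bsub>n+1\<^esub>(f) = 0\<close> imply \<open>\<Phi>\<^sub>m(f) = 0\<close> for \<open>m > n\<close>, and conversely, \<open>\<Phi>\<^bsub>n+1\<^esub>(f)\<close> being symmetric and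
  multilinear over a ring containing the rationals, it vanishes if it does so on the diagonal.\<close>

section \<open>Signed sums over the permutations of a finite set of letters\<close>

text \<open>An arbitrary \<open>S\<close> in place of \<open>{1..n}\<close> lets inductions remove
  any letter.\<close>

definition cycle_sum ::
    "nat set \<Rightarrow> ('a::comm_monoid_mult \<Rightarrow> 'b::comm_ring_1) \<Rightarrow> (nat \<Rightarrow> 'a) \<Rightarrow> 'b" where
  "cycle_sum S f a =
     (\<Sum>\<sigma> | \<sigma> permutes S. of_int (sign \<sigma>) * (\<Prod>C\<in>orbit \<sigma> ` S. cycle_value f a C))"

lemma Phi_eq_cycle_sum: "Phi n f = cycle_sum {1..n} f"
  by (simp add: fun_eq_iff Phi_def cycle_sum_def)

lemma cycle_sum_empty [simp]: "cycle_sum {} f a = 1"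
  by (simp add: cycle_sum_def)

lemma cycle_sum_cong:
  assumes "\<And>i. i \<in> S \<Longrightarrow> a i = b i"
  shows "cycle_sum S f a = cycle_sum S f b"
proof -
  have "cycle_value f a C = cycle_value f b C"
    if \<sigma>: "\<sigma> permutes S" and "C \<in> orbit \<sigma> ` S" for \<sigma> C
  proof -
    have "C \<subseteq> S"
      using that permutes_orbit_subset[OF \<sigma>] by blast
    then show ?thesis
      using assms by (auto simp: cycle_value_def intro!: arg_cong[of _ _ f] prod.cong)
  qed
  then show ?thesis
    unfolding cycle_sum_def by (intro sum.cong refl arg_cong2[of _ _ _ _ "(*)"] prod.cong) auto
qed

lemma orbit_eq_if_mem:
  assumes "permutation \<pi>" "y \<in> orbit \<pi> x"
  shows "orbit \<pi> y = orbit \<pi> x"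
  using assms orbit_cyclic_eq3[OF cyclic_on_orbit'] by metis

text \<open>The new permutation sends the preimage of \<open>b\<close> to \<open>x\<close> and
  \<open>x\<close> to \<open>b\<close>, and agrees with \<open>\<pi>\<close> elsewhere, so
  \<open>x\<close> is inserted just before \<open>b\<close>. The inclusions hold because the right
  side is closed under the new permutation, and the new orbit, within \<open>S\<close>, under
  \<open>\<pi>\<close>.\<close>

lemma orbit_transpose_comp:
  assumes S: "finite S" "x \<notin> S" "b \<in> S" and \<pi>: "\<pi> permutes S" and y: "y \<in> S"
  shows "orbit (transpose x b \<circ> \<pi>) y =
    (if b \<in> orbit \<pi> y then insert x (orbit \<pi> y) else orbit \<pi> y)"
    (is "orbit ?\<sigma> y = ?R")
proof -
  have perm\<pi>: "permutation \<pi>"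
    using \<pi> S permutation_permutes by blast
  have "?\<sigma> permutes insert x S"
    using S \<pi> by (auto intro!: permutes_compose permutes_swap_id intro: permutes_subset)
  then have perm: "permutation ?\<sigma>"
    using S permutation_permutes by (metis finite_insert)
  have \<pi>x: "\<pi> x = x"
    using \<pi> S by (simp add: permutes_not_in)
  have sub: "orbit \<pi> y \<subseteq> S"
    using permutes_orbit_subset[OF \<pi> y] .
  have in_S: "\<pi> z \<in> S" if "z \<in> S" for z
    using \<pi> that by (simp add: permutes_in_image)
  have step: "?\<sigma> z \<in> ?R" if "z \<in> ?R" for z
  proof (cases "z = x")
    case True
    with that sub S have "b \<in> orbit \<pi> y"
      by (auto split: if_splits)
    then show ?thesis
      using True \<pi>x by simp
  next
    case False
    then have z: "z \<in> orbit \<pi> y"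
      using that by (auto split: if_splits)
    then have \<pi>z: "\<pi> z \<in> orbit \<pi> y"
      by (rule orbit.step)
    then have "\<pi> z \<noteq> x"
      using sub S by auto
    then show ?thesis
      using \<pi>z by (auto simp: transpose_def)
  qed
  have y_in: "y \<in> ?R"
    using permutation_self_in_orbit[OF perm\<pi>] by auto
  have "z \<in> ?R" if "z \<in> orbit ?\<sigma> y" for z
    using that by induction (use step y_in in blast)+
  then have "orbit ?\<sigma> y \<subseteq> ?R"
    by blast
  moreover have self: "y \<in> orbit ?\<sigma> y"
    using permutation_self_in_orbit[OF perm] .
  have \<sigma>x: "?\<sigma> x = b"
    using \<pi>x by simp
  \<comment> \<open>A step of \<open>\<pi>\<close> landing on \<open>b\<close> becomes two steps of
    \<open>?\<sigma>\<close>, by way of \<open>x\<close>.\<close>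
  have closed: "\<pi> z \<in> orbit ?\<sigma> y" if z: "z \<in> S" "z \<in> orbit ?\<sigma> y" for z
  proof (cases "\<pi> z = b")
    case True
    then have "?\<sigma> z = x"
      by simp
    then have "x \<in> orbit ?\<sigma> y"
      using z(2) orbit.step by metis
    then have "?\<sigma> x \<in> orbit ?\<sigma> y"
      by (rule orbit.step)
    then show ?thesis
      using True \<sigma>x by simp
  next
    case False
    moreover have "\<pi> z \<noteq> x"
      using in_S[OF z(1)] S by auto
    ultimately have "?\<sigma> z = \<pi> z"
      by (simp add: transpose_def)
    then show ?thesis
      using z(2) orbit.step by metis
  qed
  have orb: "z \<in> orbit ?\<sigma> y" if "z \<in> orbit \<pi> y" for z
    using that
  proof induction
    case base
    then show ?case using closed[OF y self] .
  next
    case (step z)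
    then show ?case using closed[of z] sub by blast
  qed
  then have "orbit \<pi> y \<subseteq> orbit ?\<sigma> y"
    by blast
  moreover have "x \<in> orbit ?\<sigma> y" if "b \<in> orbit \<pi> y"
  proof -
    have "orbit ?\<sigma> x = orbit ?\<sigma> b"
      using permutation_orbit_step[OF perm, of x] \<sigma>x by simp
    also have "\<dots> = orbit ?\<sigma> y"
      using orbit_eq_if_mem[OF perm orb[OF that]] .
    finally show ?thesis
      using permutation_self_in_orbit[OF perm, of x] by simp
  qed
  ultimately show ?thesis
    by (intro subset_antisym) (auto simp del: comp_apply)
qed

text \<open>The letter \<open>x\<close> lies in the cycle of \<open>b\<close>, so by commutativity
  its factor can be absorbed into the entry at \<open>b\<close>. Inserting \<open>x\<close> matches
  the old orbits with the new ones.\<close>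

lemma prod_cycle_value_transpose:
  fixes f :: "'a::comm_monoid_mult \<Rightarrow> 'b::comm_ring_1"
  assumes S: "finite S" "x \<notin> S" "b \<in> S" and \<pi>: "\<pi> permutes S"
  shows "(\<Prod>C\<in>orbit (transpose x b \<circ> \<pi>) ` insert x S. cycle_value f a C) =
    (\<Prod>C\<in>orbit \<pi> ` S. cycle_value f (a(b := a x * a b)) C)"
proof -
  let ?\<sigma> = "transpose x b \<circ> \<pi>"
  define h where "h C = (if b \<in> C then insert x C else C)" for C
  have "?\<sigma> permutes insert x S"
    using S \<pi> by (auto intro!: permutes_compose permutes_swap_id intro: permutes_subset)
  then have perm: "permutation ?\<sigma>"
    using S permutation_permutes by (metis finite_insert)
  have "\<pi> x = x"
    using \<pi> S by (simp add: permutes_not_in)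
  then have "orbit ?\<sigma> x = orbit ?\<sigma> b"
    using permutation_orbit_step[OF perm, of x] by simp
  then have "orbit ?\<sigma> ` insert x S = orbit ?\<sigma> ` S"
    using S by auto
  also have "\<dots> = h ` orbit \<pi> ` S"
    using orbit_transpose_comp[OF S \<pi>] by (auto simp: h_def image_image intro!: image_cong)
  finally have img: "orbit ?\<sigma> ` insert x S = h ` orbit \<pi> ` S" .
  have C: "x \<notin> C" "finite C" if "C \<in> orbit \<pi> ` S" for C
    using that permutes_orbit_subset[OF \<pi>] S finite_subset by blast+
  have "inj_on h (orbit \<pi> ` S)"
  proof (rule inj_on_inverseI)
    show "h C - {x} = C" if "C \<in> orbit \<pi> ` S" for C
      using C[OF that] by (auto simp: h_def)
  qed
  then have "(\<Prod>C\<in>orbit ?\<sigma> ` insert x S. cycle_value f a C) =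
      (\<Prod>C\<in>orbit \<pi> ` S. cycle_value f a (h C))"
    unfolding img by (simp add: prod.reindex)
  also have "\<dots> = (\<Prod>C\<in>orbit \<pi> ` S. cycle_value f (a(b := a x * a b)) C)"
  proof (rule prod.cong)
    fix C assume "C \<in> orbit \<pi> ` S"
    note C = C[OF this]
    have "(\<Prod>i\<in>h C. a i) = (\<Prod>i\<in>C. (a(b := a x * a b)) i)"
    proof (cases "b \<in> C")
      case True
      then show ?thesis
        using C by (simp add: h_def prod.remove[of C b] mult.assoc)
    next
      case False
      then show ?thesis
        by (auto simp: h_def intro!: prod.cong)
    qed
    then show "cycle_value f a (h C) = cycle_value f (a(b := a x * a b)) C"
      by (simp add: cycle_value_def)
  qed simp
  finally show ?thesis .
qed

lemma prod_cycle_value_fixpoint: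
  fixes f :: "'a::comm_monoid_mult \<Rightarrow> 'b::comm_ring_1"
  assumes S: "finite S" "x \<notin> S" and \<pi>: "\<pi> permutes S"
  shows "(\<Prod>C\<in>orbit \<pi> ` insert x S. cycle_value f a C) =
    f (a x) * (\<Prod>C\<in>orbit \<pi> ` S. cycle_value f a C)"
proof -
  have "orbit \<pi> x = {x}"
    using \<pi> S by (simp add: orbit_eq_singleton_iff permutes_not_in)
  moreover have "{x} \<notin> orbit \<pi> ` S"
    using S permutes_orbit_subset[OF \<pi>] by blast
  ultimately show ?thesis
    using S by (simp add: cycle_value_def)
qed

text \<open>A permutation of \<open>insert x S\<close> arises from one of \<open>S\<close> either by making \<open>x\<close> a fixed point
  or by placing \<open>x\<close> in front of some \<open>b\<close> in the cycle of \<open>b\<close>, which reverses the sign.\<close>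

lemma cycle_sum_insert:
  fixes f :: "'a::comm_monoid_mult \<Rightarrow> 'b::comm_ring_1"
  assumes S: "finite S" "x \<notin> S"
  shows "cycle_sum (insert x S) f a =
    f (a x) * cycle_sum S f a - (\<Sum>b\<in>S. cycle_sum S f (a(b := a x * a b)))"
proof -
  let ?P = "\<lambda>\<sigma>. of_int (sign \<sigma>) * (\<Prod>C\<in>orbit \<sigma> ` insert x S. cycle_value f a C)"
  have "(\<Sum>\<pi> | \<pi> permutes S. ?P \<pi>) = f (a x) * cycle_sum S f a"
    using S unfolding cycle_sum_def sum_distrib_left
    by (intro sum.cong) (simp_all add: prod_cycle_value_fixpoint mult.left_commute
      del: image_insert)
  moreover have "(\<Sum>\<pi> | \<pi> permutes S. ?P (transpose x b \<circ> \<pi>)) =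
      - cycle_sum S f (a(b := a x * a b))" if b: "b \<in> S" for b
  proof -
    have "sign (transpose x b \<circ> \<pi>) = - sign \<pi>" if \<pi>: "\<pi> permutes S" for \<pi>
    proof -
      have "permutation \<pi>"
        using \<pi> S permutation_permutes by blast
      moreover have "x \<noteq> b"
        using b S by auto
      ultimately show ?thesis
        by (simp add: sign_compose permutation_swap_id sign_swap_id)
    qed
    then show ?thesis
      unfolding cycle_sum_def sum_negf[symmetric] using S b
      by (intro sum.cong) (simp_all add: prod_cycle_value_transpose del: image_insert)
  qed
  moreover have "cycle_sum (insert x S) f a =
      (\<Sum>b\<in>insert x S. \<Sum>\<pi> | \<pi> permutes S. ?P (transpose x b \<circ> \<pi>))"
    unfolding cycle_sum_def by (rule sum_over_permutations_insert[OF S])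
  ultimately show ?thesis
    using S by (simp add: sum_negf del: image_insert)
qed

text \<open>With \<open>h\<close> a permutation of \<open>S\<close> this is symmetry in the
  arguments; with \<open>Suc\<close> it renumbers the letters. Induction along
  \<open>cycle_sum_insert\<close> avoids conjugating permutations.\<close>

lemma cycle_sum_reindex:
  fixes f :: "'a::comm_monoid_mult \<Rightarrow> 'b::comm_ring_1"
  assumes "finite S" "inj_on h S"
  shows "cycle_sum (h ` S) f a = cycle_sum S f (a \<circ> h)"
  using assms
proof (induction S arbitrary: a rule: finite_induct)
  case (insert x S)
  have inj: "inj_on h S" and hx: "h x \<notin> h ` S"
    using insert by auto
  have eq: "cycle_sum S f ((a(h b := c)) \<circ> h) = cycle_sum S f ((a \<circ> h)(b := c))" if "b \<in> S" for b c
    using inj that by (intro cycle_sum_cong) (auto simp: inj_on_def)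
  have "cycle_sum (h ` insert x S) f a =
      f (a (h x)) * cycle_sum (h ` S) f a -
      (\<Sum>b\<in>S. cycle_sum (h ` S) f (a(h b := a (h x) * a (h b))))"
    using insert.hyps hx inj by (simp add: cycle_sum_insert sum.reindex)
  also have "(\<Sum>b\<in>S. cycle_sum (h ` S) f (a(h b := a (h x) * a (h b)))) =
      (\<Sum>b\<in>S. cycle_sum S f ((a \<circ> h)(b := a (h x) * a (h b))))"
    by (intro sum.cong refl) (simp only: insert.IH[OF inj] eq)
  finally show ?case
    using insert.hyps insert.IH[OF inj] by (simp add: cycle_sum_insert comp_def)
qed simp

section \<open>Multilinearity and polarization\<close>

text \<open>Splitting off the letter \<open>c\<close> itself puts its entry \<open>w\<close> into
  \<open>f w\<close> and into the products \<open>w * a b\<close>. The latter are additive in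
  \<open>w\<close> by induction, applied to slot \<open>b\<close> of a smaller set.\<close>

lemma cycle_sum_add:
  fixes f :: "'a::{comm_ring, comm_monoid_mult} \<Rightarrow> 'b::comm_ring_1"
  assumes f: "\<And>x y. f (x + y) = f x + f y" and "finite S" "c \<in> S"
  shows "cycle_sum S f (a(c := u + v)) = cycle_sum S f (a(c := u)) + cycle_sum S f (a(c := v))"
  using assms(2,3)
proof (induction "card S" arbitrary: S c a u v)
  case (Suc m)
  define T where "T = S - {c}"
  have S: "S = insert c T" "finite T" "c \<notin> T" and m: "m = card T"
    using Suc by (auto simp: T_def)
  have key: "cycle_sum S f (a(c := w)) =
      f w * cycle_sum T f a - (\<Sum>b\<in>T. cycle_sum T f (a(b := w * a b)))" for w
    unfolding S(1) cycle_sum_insert[OF S(2,3)] using S(3)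
    by (intro arg_cong2[of _ _ _ _ minus] arg_cong2[of _ _ _ _ times] sum.cong cycle_sum_cong)
      auto
  have "cycle_sum T f (a(b := (u + v) * a b)) =
      cycle_sum T f (a(b := u * a b)) + cycle_sum T f (a(b := v * a b))" if "b \<in> T" for b
    using Suc.hyps(1)[OF m S(2) that] by (simp add: distrib_right)
  then show ?case
    by (simp add: key f distrib_right sum.distrib)
qed simp

lemma cycle_sum_zero:
  fixes f :: "'a::{comm_ring, comm_monoid_mult} \<Rightarrow> 'b::comm_ring_1"
  assumes "\<And>x y. f (x + y) = f x + f y" "finite S" "c \<in> S"
  shows "cycle_sum S f (a(c := 0)) = 0"
  using cycle_sum_add[OF assms, of a 0 0] by simp

lemma cycle_sum_sum:
  fixes f :: "'a::{comm_ring, comm_monoid_mult} \<Rightarrow> 'b::comm_ring_1"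
  assumes "\<And>x y. f (x + y) = f x + f y" "finite S" "c \<in> S"
  shows "cycle_sum S f (a(c := \<Sum>j\<in>T. u j)) = (\<Sum>j\<in>T. cycle_sum S f (a(c := u j)))"
  by (induction T rule: infinite_finite_induct)
    (simp_all add: cycle_sum_zero[OF assms] cycle_sum_add[OF assms] del: fun_upd_apply)

lemma sum_PiE_insert:
  fixes g :: "('i \<Rightarrow> 'j) \<Rightarrow> 'b::comm_monoid_add"
  assumes "c \<notin> K"
  shows "(\<Sum>h\<in>insert c K \<rightarrow>\<^sub>E T. g h) = (\<Sum>j\<in>T. \<Sum>h\<in>K \<rightarrow>\<^sub>E T. g (h(c := j)))"
proof -
  have "inj_on (\<lambda>(y, h). h(c := y)) (T \<times> (K \<rightarrow>\<^sub>E T))"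
    using inj_combinator[OF assms, of "\<lambda>_. T"] .
  then show ?thesis
    by (simp add: PiE_insert_eq sum.reindex sum.cartesian_product case_prod_unfold o_def)
qed

text \<open>Slots are expanded one at a time, and \<open>K\<close> collects those already treated.
  The case \<open>K = S\<close> is the full multilinear expansion.\<close>

lemma cycle_sum_expand:
  fixes f :: "'a::{comm_ring, comm_monoid_mult} \<Rightarrow> 'b::comm_ring_1"
  assumes f: "\<And>x y. f (x + y) = f x + f y" and S: "finite S" "K \<subseteq> S"
  shows "cycle_sum S f (\<lambda>i. if i \<in> K then \<Sum>j\<in>T. x j else a i) =
    (\<Sum>h\<in>K \<rightarrow>\<^sub>E T. cycle_sum S f (\<lambda>i. if i \<in> K then x (h i) else a i))"
proof -
  have "finite K"
    using S finite_subset by blast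
  then show ?thesis
    using S(2)
  proof (induction K arbitrary: a rule: finite_induct)
    case (insert c K)
    have upd: "(\<lambda>i. if i \<in> insert c K then p i else a i) =
        (\<lambda>i. if i \<in> K then p i else (a(c := p c)) i)" for p
      using insert.hyps by auto
    have upd': "(\<lambda>i. if i \<in> K then p i else (a(c := u)) i) =
        (\<lambda>i. if i \<in> K then p i else a i)(c := u)" for p u
      using insert.hyps by auto
    have upd'': "(\<lambda>i. if i \<in> K then x ((h(c := j)) i) else b i) =
        (\<lambda>i. if i \<in> K then x (h i) else b i)" for h j b
      using insert.hyps by auto
    have "cycle_sum S f (\<lambda>i. if i \<in> insert c K then \<Sum>j\<in>T. x j else a i) =
        (\<Sum>h\<in>K \<rightarrow>\<^sub>E T. \<Sum>j\<in>T. cycle_sum S f ((\<lambda>i. if i \<in> K then x (h i) else a i)(c := x j)))"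
      unfolding upd[of "\<lambda>_. \<Sum>j\<in>T. x j"] using insert.prems
      by (subst insert.IH) (simp_all add: upd' cycle_sum_sum[OF f S(1)] del: fun_upd_apply)
    also have "\<dots> = (\<Sum>h\<in>insert c K \<rightarrow>\<^sub>E T.
        cycle_sum S f (\<lambda>i. if i \<in> insert c K then x (h i) else a i))"
      unfolding sum_PiE_insert[OF insert.hyps(2)] upd upd'' upd'
      by (subst sum.swap) simp
    finally show ?case .
  qed simp
qed

text \<open>Both sides evaluate the product over \<open>S\<close> of the indicator of
  \<open>i \<notin> H\<close> minus 1: each factor is -1 on \<open>H\<close> and 0 off it.\<close>

lemma alternating_sum_avoiding:
  fixes S H :: "'i set"
  assumes "finite S"
  shows "(\<Sum>B\<in>Pow S. (-1) ^ card (S - B) * of_bool (H \<inter> B = {})) =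
    (if S \<subseteq> H then (-1) ^ card S else (0::'b::comm_ring_1))"
proof -
  have "(\<Prod>i\<in>S. of_bool (i \<notin> H) + - 1) =
      (\<Sum>B\<in>Pow S. (\<Prod>i\<in>B. of_bool (i \<notin> H)) * (\<Prod>i\<in>S - B. - 1 :: 'b))"
    by (rule prod_add[OF assms])
  also have "\<dots> = (\<Sum>B\<in>Pow S. (-1) ^ card (S - B) * of_bool (H \<inter> B = {}))"
  proof (rule sum.cong)
    fix B assume "B \<in> Pow S"
    then have "finite B"
      using assms finite_subset by blast
    then have "(\<Prod>i\<in>B. of_bool (i \<notin> H)) = (of_bool (H \<inter> B = {}) :: 'b)"
      by (induction B rule: finite_induct) auto
    then show "(\<Prod>i\<in>B. of_bool (i \<notin> H)) * (\<Prod>i\<in>S - B. - 1 :: 'b) =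
        (-1) ^ card (S - B) * of_bool (H \<inter> B = {})"
      by simp
  qed simp
  also have "(\<Prod>i\<in>S. of_bool (i \<notin> H) + - 1) = (if S \<subseteq> H then (-1) ^ card S else (0::'b))"
  proof (cases "S \<subseteq> H")
    case True
    then have "(\<Prod>i\<in>S. of_bool (i \<notin> H) + - 1) = (\<Prod>i\<in>S. - 1 :: 'b)"
      by (intro prod.cong) auto
    then show ?thesis
      using True by simp
  next
    case False
    then obtain i where "i \<in> S" "i \<notin> H"
      by auto
    then have "(\<Prod>i\<in>S. of_bool (i \<notin> H) + - 1) = (0::'b)"
      using assms by (simp add: prod.remove)
    then show ?thesis
      using False by simp
  qed
  finally show ?thesis ..
qed

text \<open>Inclusion-exclusion: expanding the diagonal values at the partial sums of \<open>a\<close> by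
  multilinearity, only the terms that use every \<open>a i\<close> once survive the alternating sum.\<close>

lemma cycle_sum_polarization:
  fixes f :: "'a::{comm_ring, comm_monoid_mult} \<Rightarrow> 'b::comm_ring_1"
  assumes f: "\<And>x y. f (x + y) = f x + f y" and S: "finite S"
    and diag: "\<And>x. cycle_sum S f (\<lambda>_. x) = 0"
  shows "of_nat (card {h \<in> S \<rightarrow>\<^sub>E S. S \<subseteq> h ` S}) * cycle_sum S f a = 0"
proof -
  let ?F = "cycle_sum S f" and ?E = "S \<rightarrow>\<^sub>E S"
  have fin: "finite ?E"
    using S by (simp add: finite_PiE)
  have expand: "?F (\<lambda>_. \<Sum>j\<in>S - B. a j) = (\<Sum>h\<in>?E. of_bool (h ` S \<inter> B = {}) * ?F (a \<circ> h))" for B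
  proof -
    have "?F (\<lambda>_. \<Sum>j\<in>S - B. a j) = ?F (\<lambda>i. if i \<in> S then \<Sum>j\<in>S - B. a j else a i)"
      by (rule cycle_sum_cong) simp
    also have "\<dots> = (\<Sum>h\<in>S \<rightarrow>\<^sub>E (S - B). ?F (\<lambda>i. if i \<in> S then a (h i) else a i))"
      by (rule cycle_sum_expand[OF f S order_refl])
    also have "\<dots> = (\<Sum>h\<in>S \<rightarrow>\<^sub>E (S - B). ?F (a \<circ> h))"
      by (intro sum.cong refl cycle_sum_cong) simp
    also have "S \<rightarrow>\<^sub>E (S - B) = {h \<in> ?E. h ` S \<inter> B = {}}"
      by (auto simp: PiE_iff extensional_def)
    also have "sum (\<lambda>h. ?F (a \<circ> h)) \<dots> = (\<Sum>h\<in>?E. of_bool (h ` S \<inter> B = {}) * ?F (a \<circ> h))"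
      unfolding sum.inter_filter[OF fin] by (intro sum.cong) auto
    finally show ?thesis .
  qed
  have "0 = (\<Sum>B\<in>Pow S. (-1) ^ card (S - B) * ?F (\<lambda>_. \<Sum>j\<in>S - B. a j))"
    by (simp add: diag)
  also have "\<dots> = (\<Sum>h\<in>?E. \<Sum>B\<in>Pow S. (-1) ^ card (S - B) * of_bool (h ` S \<inter> B = {}) * ?F (a \<circ> h))"
    unfolding expand sum_distrib_left mult.assoc by (rule sum.swap)
  also have "\<dots> = (\<Sum>h\<in>?E. if S \<subseteq> h ` S then (-1) ^ card S * ?F a else 0)"
  proof (rule sum.cong)
    fix h assume h: "h \<in> ?E"
    \<comment> \<open>A map of the finite set \<open>S\<close> onto itself is a permutation, so
      symmetry applies.\<close>
    have "?F (a \<circ> h) = ?F a" if "S \<subseteq> h ` S"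
    proof -
      have "h ` S = S"
        using h that by (auto simp: PiE_iff)
      moreover from this have "inj_on h S"
        using S by (intro eq_card_imp_inj_on) auto
      ultimately show ?thesis
        using cycle_sum_reindex[OF S, of h f a] by simp
    qed
    then show "(\<Sum>B\<in>Pow S. (-1) ^ card (S - B) * of_bool (h ` S \<inter> B = {}) * ?F (a \<circ> h)) =
        (if S \<subseteq> h ` S then (-1) ^ card S * ?F a else 0)"
      unfolding sum_distrib_right[symmetric] alternating_sum_avoiding[OF S] by auto
  qed simp
  also have "\<dots> = (-1) ^ card S * (of_nat (card {h \<in> ?E. S \<subseteq> h ` S}) * ?F a)"
    unfolding sum.inter_filter[OF fin, symmetric] by simp
  finally have "(-1) ^ card S * ((-1) ^ card S * (of_nat (card {h \<in> ?E. S \<subseteq> h ` S}) * ?F a)) = 0"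
    by simp
  then show ?thesis
    by (simp add: mult.assoc[symmetric] flip: power_add)
qed

text \<open>The ring may have zero divisors, so cancellation is restricted to units.\<close>

lemma unit_cancel:
  fixes x y u :: "'b::comm_ring_1"
  assumes "u dvd 1" "u * x = u * y"
  shows "x = y"
  using assms by (metis dvdE mult.commute mult.left_commute mult_1)

lemma unit_cancel_iff:
  fixes x y u :: "'b::comm_ring_1"
  assumes "u dvd 1"
  shows "u * x = u * y \<longleftrightarrow> x = y"
  using unit_cancel[OF assms] by auto

lemma cycle_sum_eq_0_if_diagonal:
  fixes f :: "'a::{comm_ring, comm_monoid_mult} \<Rightarrow> 'b::comm_ring_1"
  assumes units: "\<And>m. 0 < m \<Longrightarrow> (of_nat m :: 'b) dvd 1"
    and f: "\<And>x y. f (x + y) = f x + f y" and S: "finite S"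
    and diag: "\<And>x. cycle_sum S f (\<lambda>_. x) = 0"
  shows "cycle_sum S f a = 0"
proof -
  let ?H = "{h \<in> S \<rightarrow>\<^sub>E S. S \<subseteq> h ` S}"
  \<comment> \<open>The cardinality is the factorial of \<open>card S\<close>, but positivity
    suffices to make it a unit, and the identity witnesses that.\<close>
  have "restrict id S \<in> ?H"
    by auto
  moreover have "finite ?H"
    using S by (simp add: finite_PiE)
  ultimately have "0 < card ?H"
    using card_gt_0_iff by blast
  then show ?thesis
    using unit_cancel[OF units, of "card ?H" _ 0] cycle_sum_polarization[OF f S diag] by simp
qed

section \<open>Newton's identities for the diagonal values\<close>

lemma cycle_sum_const_card:
  fixes f :: "'a::comm_monoid_mult \<Rightarrow> 'b::comm_ring_1"
  assumes "finite S"
  shows "cycle_sum S f (\<lambda>_. x) = cycle_sum {..<card S} f (\<lambda>_. x)"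
proof -
  obtain h where "bij_betw h {..<card S} S"
    using ex_bij_betw_nat_finite[OF assms] by (auto simp: atLeast0LessThan)
  then show ?thesis
    using cycle_sum_reindex[of "{..<card S}" h f "\<lambda>_. x"]
    by (simp add: bij_betw_def comp_def)
qed

text \<open>The sign makes \<open>d m\<close> a coefficient of the polynomial with power sums \<open>f (x ^ q)\<close>, rather
  than an elementary symmetric function. The power \<open>k\<close> is needed because the recursion multiplies
  one entry by another.\<close>

lemma cycle_sum_one_power:
  fixes f :: "'a::comm_monoid_mult \<Rightarrow> 'b::comm_ring_1"
  assumes d: "\<And>m. cycle_sum {..<m} f (\<lambda>_. x) = (-1) ^ m * (of_nat (fact m) * d m)"
    and "finite S" "b \<notin> S"
  shows "cycle_sum (insert b S) f ((\<lambda>_. x)(b := x ^ k)) =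
    (-1) ^ card S * (of_nat (fact (card S)) * (\<Sum>j\<le>card S. f (x ^ (k + j)) * d (card S - j)))"
  using assms(2,3)
proof (induction "card S" arbitrary: S b k)
  case 0
  then have "S = {}"
    by simp
  moreover have "d 0 = 1"
    using d[of 0] by simp
  ultimately show ?case
    using cycle_sum_insert[of "{}" b f] by simp
next
  case (Suc m)
  define a where "a = (\<lambda>_. x)(b := x ^ k)"
  have const: "cycle_sum S f a = cycle_sum S f (\<lambda>_. x)"
    unfolding a_def using Suc.prems by (intro cycle_sum_cong) auto
  \<comment> \<open>Merging \<open>b\<close> into \<open>c\<close> leaves, on \<open>S\<close>, a
    constant family whose one exception is \<open>x ^ Suc k\<close> at \<open>c\<close>: the
    induction hypothesis with one letter fewer.\<close>
  have term_eq: "cycle_sum S f (a(c := a b * a c)) =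
      (-1) ^ m * (of_nat (fact m) * (\<Sum>j\<le>m. f (x ^ (Suc k + j)) * d (m - j)))" if c: "c \<in> S" for c
  proof -
    have "c \<noteq> b"
      using c Suc.prems by auto
    have card: "card (S - {c}) = m"
      using c Suc.prems by (simp flip: Suc.hyps(2))
    then have "cycle_sum S f (a(c := a b * a c)) =
        cycle_sum S f ((\<lambda>_. x)(c := x ^ Suc k))"
      using Suc.prems by (intro cycle_sum_cong) (auto simp: a_def mult.commute)
    also have "\<dots> = cycle_sum (insert c (S - {c})) f ((\<lambda>_. x)(c := x ^ Suc k))"
      using c by (simp add: insert_absorb)
    also have "\<dots> = (-1) ^ m * (of_nat (fact m) * (\<Sum>j\<le>m. f (x ^ (Suc k + j)) * d (m - j)))"
      using Suc.hyps(1)[of "S - {c}" c "Suc k"] Suc.prems card by simp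
    finally show ?thesis .
  qed
  have sum: "(\<Sum>c\<in>S. cycle_sum S f (a(c := a b * a c))) =
      of_nat (Suc m) * ((-1) ^ m * (of_nat (fact m) * (\<Sum>j\<le>m. f (x ^ (Suc k + j)) * d (m - j))))"
    using sum.cong[OF refl term_eq, of S "\<lambda>c. c"] by (simp only: sum_constant Suc.hyps(2))
  have "cycle_sum (insert b S) f a =
      f (x ^ k) * cycle_sum S f (\<lambda>_. x) -
      of_nat (Suc m) * ((-1) ^ m * (of_nat (fact m) * (\<Sum>j\<le>m. f (x ^ (Suc k + j)) * d (m - j))))"
    unfolding cycle_sum_insert[OF Suc.prems] sum const by (simp add: a_def)
  \<comment> \<open>This term supplies the summand \<open>j = 0\<close>; the factor
    \<open>Suc m\<close> of the other one completes the factorial.\<close>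
  also have "cycle_sum S f (\<lambda>_. x) = (-1) ^ Suc m * (of_nat (fact (Suc m)) * d (Suc m))"
    unfolding cycle_sum_const_card[OF Suc.prems(1), of f x] d Suc.hyps(2)[symmetric] ..
  finally show ?case
    unfolding a_def[symmetric] Suc.hyps(2)[symmetric] sum.atMost_Suc_shift
    by (simp add: algebra_simps)
qed

text \<open>For generating series D of \<open>d\<close> and S of the shifted \<open>s\<close>, this
  is D' = -S D, as satisfied by a product of factors 1 - x_i X with power sums \<open>s\<close>. The
  value \<open>s 0\<close> is absent, and \<open>d 0\<close> is free.\<close>

definition newton_recurrence :: "(nat \<Rightarrow> 'b::comm_ring_1) \<Rightarrow> (nat \<Rightarrow> 'b) \<Rightarrow> bool" where
  "newton_recurrence s d \<longleftrightarrow>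
    (\<forall>m. of_nat (Suc m) * d (Suc m) + (\<Sum>j\<le>m. s (Suc j) * d (m - j)) = 0)"

lemma newton_recurrence_Suc:
  assumes "newton_recurrence s d"
  shows "of_nat (Suc m) * d (Suc m) = - (\<Sum>j\<le>m. s (Suc j) * d (m - j))"
  using assms unfolding newton_recurrence_def eq_neg_iff_add_eq_0 by blast

text \<open>Each coefficient is determined by the earlier ones after division by
  \<open>Suc m\<close>, and the recursion is linear. The factor \<open>c 0\<close> accommodates
  polynomials that are not monic.\<close>

lemma newton_recurrence_unique:
  fixes s c d :: "nat \<Rightarrow> 'b::comm_ring_1"
  assumes units: "\<And>m. 0 < m \<Longrightarrow> (of_nat m :: 'b) dvd 1"
    and c: "newton_recurrence s c" and d: "newton_recurrence s d" and d0: "d 0 = 1"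
  shows "c m = c 0 * d m"
proof (induction m rule: less_induct)
  case (less m)
  show ?case
  proof (cases m)
    case 0
    then show ?thesis
      using d0 by simp
  next
    case (Suc k)
    have IH: "c (k - j) = c 0 * d (k - j)" for j
      by (rule less.IH) (simp add: Suc)
    have "of_nat (Suc k) * c (Suc k) = - (\<Sum>j\<le>k. s (Suc j) * c (k - j))"
      by (rule newton_recurrence_Suc[OF c])
    also have "\<dots> = c 0 * - (\<Sum>j\<le>k. s (Suc j) * d (k - j))"
      by (simp only: IH sum_distrib_left mult_minus_right mult.left_commute)
    also have "- (\<Sum>j\<le>k. s (Suc j) * d (k - j)) = of_nat (Suc k) * d (Suc k)"
      by (rule newton_recurrence_Suc[OF d, symmetric])
    finally have "of_nat (Suc k) * c (Suc k) = of_nat (Suc k) * (c 0 * d (Suc k))"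
      by (simp add: mult.left_commute)
    then show ?thesis
      using unit_cancel[OF units[of "Suc k"]] Suc by simp
  qed
qed

text \<open>The equation at 0 gives \<open>s 0 = of_nat n\<close> after cancelling
  \<open>c 0\<close>. In the later ones the summand \<open>s 0 * c m\<close> then cancels the
  contribution of \<open>n\<close> to \<open>n - m\<close>.\<close>

lemma newton_recurrence_iff:
  fixes s c :: "nat \<Rightarrow> 'b::comm_ring_1"
  assumes c0: "c 0 dvd 1" and c: "\<And>m. n < m \<Longrightarrow> c m = 0"
  shows "(\<forall>m. (\<Sum>j\<le>m. s j * c (m - j)) = of_nat (n - m) * c m) \<longleftrightarrow>
    s 0 = of_nat n \<and> newton_recurrence s c"
proof -
  \<comment> \<open>Truncated subtraction does no harm, since \<open>c\<close> vanishes beyond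
    \<open>n\<close>.\<close>
  have diff: "of_nat (n - m) * c m = of_nat n * c m - of_nat m * c m" for m
    by (cases "m \<le> n") (simp_all add: c of_nat_diff algebra_simps)
  have 0: "(\<Sum>j\<le>0. s j * c (0 - j)) = of_nat (n - 0) * c 0 \<longleftrightarrow> s 0 = of_nat n"
    using unit_cancel[OF c0, of "s 0" "of_nat n"] by (auto simp: mult.commute)
  have Suc: "(\<Sum>j\<le>Suc m. s j * c (Suc m - j)) = of_nat (n - Suc m) * c (Suc m) \<longleftrightarrow>
      of_nat (Suc m) * c (Suc m) + (\<Sum>j\<le>m. s (Suc j) * c (m - j)) = 0" if "s 0 = of_nat n" for m
    unfolding diff sum.atMost_Suc_shift using that
    by (simp add: algebra_simps eq_neg_iff_add_eq_0)
  have split: "(\<forall>m. Q m) \<longleftrightarrow> Q 0 \<and> (\<forall>m. Q (Suc m))" for Q :: "nat \<Rightarrow> bool"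
    by (metis not0_implies_Suc)
  show ?thesis
    unfolding newton_recurrence_def
    by (subst split) (simp only: 0 Suc cong: conj_cong)
qed

lemma obtain_newton_recurrence:
  fixes f :: "'a::comm_monoid_mult \<Rightarrow> 'b::comm_ring_1"
  assumes units: "\<And>m. 0 < m \<Longrightarrow> (of_nat m :: 'b) dvd 1"
  obtains d where "d 0 = 1" "newton_recurrence (\<lambda>q. f (x ^ q)) d"
    "\<And>m. cycle_sum {..<m} f (\<lambda>_. x) = 0 \<longleftrightarrow> d m = 0"
proof -
  have "\<exists>d. cycle_sum {..<m} f (\<lambda>_. x) = (-1) ^ m * (of_nat (fact m) * d)" for m
  proof -
    obtain u :: 'b where u: "of_nat (fact m) * u = 1"
      using units[of "fact m"] by (metis dvdE fact_gt_zero)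
    have "(-1) ^ m * (of_nat (fact m) * ((-1) ^ m * u * cycle_sum {..<m} f (\<lambda>_. x))) =
        ((-1) ^ m * (-1) ^ m) * (of_nat (fact m) * u) * cycle_sum {..<m} f (\<lambda>_. x)"
      by (simp only: mult_ac)
    then have "cycle_sum {..<m} f (\<lambda>_. x) =
        (-1) ^ m * (of_nat (fact m) * ((-1) ^ m * u * cycle_sum {..<m} f (\<lambda>_. x)))"
      by (simp add: u flip: power_add)
    then show ?thesis ..
  qed
  then obtain d where d: "\<And>m. cycle_sum {..<m} f (\<lambda>_. x) = (-1) ^ m * (of_nat (fact m) * d m)"
    by metis
  have "d 0 = 1"
    using d[of 0] by simp
  have sign_unit: "(-1) ^ m dvd (1::'b)" for m
    by (rule dvdI[of _ _ "(-1) ^ m"]) (simp flip: power_add)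
  have cancel: "y = z" if "(-1) ^ m * (of_nat (fact m) * y) = (-1) ^ m * (of_nat (fact m) * z)"
    for m and y z :: 'b
    using that unit_cancel[OF sign_unit] unit_cancel[OF units[of "fact m"]] by (metis fact_gt_zero)
  have "newton_recurrence (\<lambda>q. f (x ^ q)) d"
    unfolding newton_recurrence_def
  proof
    fix m
    \<comment> \<open>Writing \<open>x\<close> as \<open>x ^ 1\<close> views the constant family as
      one with an exceptional entry.\<close>
    have "cycle_sum {..<Suc m} f (\<lambda>_. x) = cycle_sum (insert m {..<m}) f ((\<lambda>_. x)(m := x ^ 1))"
      by (simp add: lessThan_Suc fun_upd_idem)
    also have "\<dots> = (-1) ^ m * (of_nat (fact m) * (\<Sum>j\<le>m. f (x ^ Suc j) * d (m - j)))"
      using cycle_sum_one_power[OF d, of "{..<m}" m 1] by simp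
    finally have "(-1) ^ m * (of_nat (fact m) * (\<Sum>j\<le>m. f (x ^ Suc j) * d (m - j))) =
        (-1) ^ m * (of_nat (fact m) * - (of_nat (Suc m) * d (Suc m)))"
      unfolding d by (simp add: algebra_simps)
    from cancel[OF this]
    show "of_nat (Suc m) * d (Suc m) + (\<Sum>j\<le>m. f (x ^ Suc j) * d (m - j)) = 0"
      by simp
  qed
  moreover have "cycle_sum {..<m} f (\<lambda>_. x) = 0 \<longleftrightarrow> d m = 0" for m
    using cancel[of m "d m" 0] d[of m] by auto
  ultimately show thesis
    using that \<open>d 0 = 1\<close> by blast
qed

text \<open>By \<open>cycle_sum_insert\<close> a value on \<open>n + 1\<close> letters combines
  values on \<open>n\<close> letters. These have altered entries, hence the hypothesis for all
  families.\<close>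

lemma cycle_sum_eq_0_mono:
  fixes f :: "'a::comm_monoid_mult \<Rightarrow> 'b::comm_ring_1"
  assumes "\<And>a. cycle_sum {..<m} f a = 0" "m \<le> n"
  shows "cycle_sum {..<n} f a = 0"
  using assms(2)
proof (induction n arbitrary: a rule: dec_induct)
  case base
  show ?case by (rule assms(1))
next
  case (step n)
  then show ?case
    by (simp add: lessThan_Suc cycle_sum_insert)
qed

section \<open>Coefficients of the logarithmic derivative\<close>

lemma coeff_poly_deriv:
  fixes p :: "'b::comm_ring_1 poly"
  shows "coeff (poly_deriv p) k = of_nat (Suc k) * coeff p (Suc k)"
proof -
  have "coeff (poly_deriv p) k =
      (\<Sum>i\<le>degree p. if i = Suc k then of_nat i * coeff p i else 0)"
    unfolding poly_deriv_def coeff_sum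
  proof (rule sum.cong)
    show "coeff (monom (of_nat i * coeff p i) (i - 1)) k =
        (if i = Suc k then of_nat i * coeff p i else 0)" for i
      by (cases i) auto
  qed simp
  then show ?thesis
    by (simp add: sum.delta' coeff_eq_0)
qed

text \<open>Multiplication by \<open>p\<close> and by X^n, with X = 1/t, turns the equation of
  Laurent series into one of power series. Here \<open>c\<close> lists the coefficients of the
  reversed polynomial X^n p(1/X).\<close>

lemma power_trace_series_eq_log_deriv_iff:
  fixes p :: "'b::comm_ring_1 poly"
  assumes deg: "degree p = n" and lead: "lead_coeff p dvd 1"
  defines "c \<equiv> \<lambda>j. if j \<le> n then coeff p (n - j) else 0"
  shows "power_trace_series f x = log_deriv p \<longleftrightarrow>
    f (x ^ 0) = of_nat n \<and> newton_recurrence (\<lambda>q. f (x ^ q)) c"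
proof -
  let ?P = "poly_at_infinity p" and ?T = "Abs_fps (\<lambda>q. f (x ^ q))"
  define C where "C = Abs_fps c"
  define G where "G = Abs_fps (\<lambda>m. of_nat (n - m) * c m)"
  have P: "fls_X ^ n * ?P = fps_to_fls C"
    unfolding fls_X_power_times_conv_shift C_def
    by (rule fls_eqI) (auto simp: poly_at_infinity_nth c_def deg coeff_eq_0 nat_diff_distrib
      intro!: arg_cong[of _ _ "coeff p"])
  \<comment> \<open>The derivative has degree below \<open>n\<close>, so a factor X splits off; it
    matches the one in \<open>power_trace_series\<close>.\<close>
  have P': "fls_X ^ n * poly_at_infinity (poly_deriv p) = fls_X * fps_to_fls G"
  proof (rule fls_eqI)
    fix k :: int
    consider "k \<le> 0" | "int n < k" | i where "k = int (Suc i)" "i < n"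
      by (metis linorder_not_le zero_less_imp_eq_int Suc_pred Suc_less_eq of_nat_0_less_iff
        not_less_eq of_nat_less_iff)
    then show "fls_nth (fls_X ^ n * poly_at_infinity (poly_deriv p)) k = fls_nth (fls_X * fps_to_fls G) k"
      unfolding fls_X_power_times_conv_shift fls_X_times_conv_shift G_def
    proof cases
      case 1
      then have "n < Suc (nat (int n - k))"
        by linarith
      then show "fls_nth (fls_shift (- int n) (poly_at_infinity (poly_deriv p))) k =
          fls_nth (fls_shift (-1) (fps_to_fls (Abs_fps (\<lambda>m. of_nat (n - m) * c m)))) k"
        using 1 by (simp add: poly_at_infinity_nth coeff_poly_deriv coeff_eq_0 deg)
    next
      case 2
      then have "n \<le> nat (k - 1)"
        by linarith
      then show "fls_nth (fls_shift (- int n) (poly_at_infinity (poly_deriv p))) k =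
          fls_nth (fls_shift (-1) (fps_to_fls (Abs_fps (\<lambda>m. of_nat (n - m) * c m)))) k"
        using 2 by (simp add: poly_at_infinity_nth)
    next
      case 3
      then have "nat (int n - int (Suc i)) = n - Suc i" "Suc (n - Suc i) = n - i"
        by linarith+
      then show "fls_nth (fls_shift (- int n) (poly_at_infinity (poly_deriv p))) k =
          fls_nth (fls_shift (-1) (fps_to_fls (Abs_fps (\<lambda>m. of_nat (n - m) * c m)))) k"
        using 3 by (simp add: poly_at_infinity_nth coeff_poly_deriv c_def)
    qed
  qed
  have X: "fls_X ^ k dvd (1 :: 'b fls)" for k
    by (rule dvdI[of _ _ "fls_X_inv ^ k"])
      (simp add: fls_X_power_times_conv_shift fls_X_inv_power_conv_shift_1)
  \<comment> \<open>The constant term of \<open>C\<close> is the leading coefficient of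
    \<open>p\<close>, so \<open>C\<close> and hence \<open>?P\<close> are units and multiplying by
    \<open>?P\<close> loses nothing.\<close>
  obtain u where u: "lead_coeff p * u = 1"
    using lead by (metis dvdE)
  have "C * fps_right_inverse C u = 1"
    using u by (intro fps_right_inverse) (simp add: C_def c_def deg)
  then have "(fls_X ^ n * ?P) * fps_to_fls (fps_right_inverse C u) = 1"
    by (simp add: P flip: fls_times_fps_to_fls)
  then have "?P * (fls_X ^ n * fps_to_fls (fps_right_inverse C u)) = 1"
    by (simp only: mult_ac)
  then have unitP: "?P dvd 1"
    by (intro dvdI) (rule sym)
  have "power_trace_series f x = log_deriv p \<longleftrightarrow>
      ?P * power_trace_series f x = ?P * log_deriv p"
    by (rule unit_cancel_iff[OF unitP, symmetric])
  also have "\<dots> \<longleftrightarrow> power_trace_series f x * ?P = poly_at_infinity (poly_deriv p)"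
    unfolding log_deriv_mult[OF lead, symmetric] by (simp only: mult.commute)
  also have "\<dots> \<longleftrightarrow>
      fls_X ^ n * (power_trace_series f x * ?P) = fls_X ^ n * poly_at_infinity (poly_deriv p)"
    by (rule unit_cancel_iff[OF X, symmetric])
  also have "fls_X ^ n * (power_trace_series f x * ?P) = fls_X * fps_to_fls (?T * C)"
    unfolding power_trace_series_def fls_times_fps_to_fls P[symmetric] by (simp only: mult_ac)
  also have "(\<dots> = fls_X ^ n * poly_at_infinity (poly_deriv p)) \<longleftrightarrow> ?T * C = G"
    unfolding P' using unit_cancel_iff[OF X[of 1]] by simp
  also have "\<dots> \<longleftrightarrow> (\<forall>m. (\<Sum>j\<le>m. f (x ^ j) * c (m - j)) = of_nat (n - m) * c m)"
    by (simp add: fps_eq_iff fps_mult_nth C_def G_def atLeast0AtMost)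
  also have "\<dots> \<longleftrightarrow> f (x ^ 0) = of_nat n \<and> newton_recurrence (\<lambda>q. f (x ^ q)) c"
    using lead by (intro newton_recurrence_iff) (auto simp: c_def deg)
  finally show ?thesis .
qed

section \<open>The equivalence for complex algebras\<close>

lemma of_nat_dvd_1_if_complex_algebra:
  fixes scale :: "complex \<Rightarrow> 'b::comm_ring_1 \<Rightarrow> 'b"
  assumes "comm_complex_algebra scale" "0 < m"
  shows "(of_nat m :: 'b) dvd 1"
proof -
  interpret comm_complex_algebra scale by fact
  have "of_nat k * x = scale (of_nat k) x" for k and x :: 'b
    by (induction k) (simp_all add: scale_left_distrib distrib_right)
  then have "1 = of_nat m * scale (1 / of_nat m) 1"
    using assms(2) by simp
  then show ?thesis
    by (rule dvdI)
qed

text \<open>Expanding p'/p in powers of 1/t divides by the leading coefficient, so degree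
  \<open>n\<close> is read as including that this coefficient is a unit. The polynomial constructed
  from a Frobenius homomorphism is monic.\<close>

theorem proposition1p7:
  fixes scaleA :: "complex \<Rightarrow> 'a::{comm_ring, comm_monoid_mult} \<Rightarrow> 'a"
    and scaleB :: "complex \<Rightarrow> 'b::comm_ring_1 \<Rightarrow> 'b"
    and f :: "'a \<Rightarrow> 'b"
    and n :: nat
  assumes "comm_complex_algebra scaleA"
    and "comm_complex_algebra scaleB"
    and "Vector_Spaces.linear scaleA scaleB f"
  shows "frobenius_hom n f \<longleftrightarrow>
    (\<forall>a. \<exists>p :: 'b poly. degree p = n \<and> lead_coeff p dvd 1 \<and>
       power_trace_series f a = log_deriv p)"
proof -
  interpret Vector_Spaces.linear scaleA scaleB f by fact
  note units = of_nat_dvd_1_if_complex_algebra[OF assms(2)]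
  have Phi_eq: "Phi (n + 1) f a = cycle_sum {..<n + 1} f (a \<circ> Suc)" for a
    using cycle_sum_reindex[of "{..<n + 1}" Suc f a]
    by (simp add: Phi_eq_cycle_sum image_Suc_lessThan)
  show ?thesis
  proof (intro iffI allI)
    fix x
    assume frob: "frobenius_hom n f"
    obtain d where d: "d 0 = 1" "newton_recurrence (\<lambda>q. f (x ^ q)) d"
      "\<And>m. cycle_sum {..<m} f (\<lambda>_. x) = 0 \<longleftrightarrow> d m = 0"
      by (rule obtain_newton_recurrence[where f = f and x = x, OF units]) (assumption, blast)
    \<comment> \<open>Shifting the indices down undoes \<open>Suc\<close>, so every family on
      \<open>{..<n + 1}\<close> is reached.\<close>
    have "cycle_sum {..<n + 1} f a = 0" for a
      using frob Phi_eq[of "a \<circ> (\<lambda>i. i - 1)"] by (simp add: frobenius_hom_def comp_def)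
    then have d_0: "d m = 0" if "n < m" for m
      using cycle_sum_eq_0_mono[of "n + 1" f m] d(3) that by auto
    \<comment> \<open>The \<open>d\<close> are read from the top, so \<open>d 0 = 1\<close> is the
      leading coefficient; by \<open>d_0\<close> stopping at \<open>n\<close> discards only
      zeros.\<close>
    define p where "p = (\<Sum>i\<le>n. monom (d (n - i)) i)"
    have coeff_p: "coeff p i = (if i \<le> n then d (n - i) else 0)" for i
      by (simp add: p_def coeff_sum)
    then have deg: "degree p = n"
      using d(1) by (intro antisym degree_le le_degree) auto
    moreover have lead: "lead_coeff p dvd 1"
      using d(1) by (simp add: deg coeff_p)
    moreover have "(\<lambda>j. if j \<le> n then coeff p (n - j) else 0) = d"
      using d_0 by (auto simp: coeff_p fun_eq_iff)
    then have "power_trace_series f x = log_deriv p"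
      using power_trace_series_eq_log_deriv_iff[OF deg lead, of f x] d(2) frob
      by (simp add: frobenius_hom_def)
    ultimately show "\<exists>p :: 'b poly. degree p = n \<and> lead_coeff p dvd 1 \<and>
       power_trace_series f x = log_deriv p"
      by blast
  next
    assume p_ex: "\<forall>a. \<exists>p :: 'b poly. degree p = n \<and> lead_coeff p dvd 1 \<and>
       power_trace_series f a = log_deriv p"
    have f1: "f 1 = of_nat n" and diag: "cycle_sum {..<n + 1} f (\<lambda>_. x) = 0" for x
    proof -
      obtain p :: "'b poly" where deg: "degree p = n" and lead: "lead_coeff p dvd 1"
        and p: "power_trace_series f x = log_deriv p"
        using p_ex by blast
      define c where "c j = (if j \<le> n then coeff p (n - j) else 0)" for j
      have c: "f 1 = of_nat n" "newton_recurrence (\<lambda>q. f (x ^ q)) c"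
        using power_trace_series_eq_log_deriv_iff[OF deg lead, of f x] p
        by (simp_all add: c_def[abs_def])
      then show "f 1 = of_nat n"
        by simp
      obtain d where d: "d 0 = 1" "newton_recurrence (\<lambda>q. f (x ^ q)) d"
        "\<And>m. cycle_sum {..<m} f (\<lambda>_. x) = 0 \<longleftrightarrow> d m = 0"
        by (rule obtain_newton_recurrence[where f = f and x = x, OF units]) (assumption, blast)
      \<comment> \<open>By uniqueness the left side is \<open>c (n + 1)\<close>, which vanishes
        because \<open>p\<close> has only \<open>n + 1\<close> coefficients.\<close>
      have "c 0 * d (n + 1) = c 0 * 0"
        using newton_recurrence_unique[OF units c(2) d(2,1), of "n + 1"] by (simp add: c_def)
      moreover have "c 0 dvd 1"
        using lead by (simp add: c_def deg)
      ultimately have "d (n + 1) = 0"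
        by (rule unit_cancel[rotated])
      then show "cycle_sum {..<n + 1} f (\<lambda>_. x) = 0"
        using d(3) by blast
    qed
    have "Phi (n + 1) f a = 0" for a
      unfolding Phi_eq by (rule cycle_sum_eq_0_if_diagonal[OF units add _ diag]) simp_all
    then show "frobenius_hom n f"
      using f1 by (simp add: frobenius_hom_def)
  qed
qed

end
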